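(* As $n\to\infty$, $ex_{bip}(n,C_6,C_8)=n^3+O(n^{5/2})$.
   Context: $C_k$ denotes the cycle with $k$ vertices. $ex_{bip}(n,C_{6},C_{8})$ denotes the maximum number of subgraphs isomorphic to $C_6$ in a bipartite graph on $n$ vertices that contains no subgraph isomorphic to $C_8$. *)

theory Defs
  imports Main "HOL-Library.Landau_Symbols"
begin

definition simple_graph_on :: "nat \<Rightarrow> nat set set \<Rightarrow> bool" where
  "simple_graph_on n E \<longleftrightarrow> E \<subseteq> {{u, v} | u v. u \<noteq> v \<and> u < n \<and> v < n}"

definition bipartite :: "nat set set \<Rightarrow> bool" where
  "bipartite E \<longleftrightarrow> (\<exists>A. \<forall>u v. {u, v} \<in> E \<longrightarrow> (u \<in> A \<longleftrightarrow> v \<notin> A))"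

text \<open>The subgraphs of E isomorphic to the cycle C_k (k \<ge> 3), each identified with its
  edge set (a cycle has no isolated vertices, so the edge set determines the subgraph).\<close>
definition cycle_subgraphs :: "nat \<Rightarrow> nat set set \<Rightarrow> nat set set set" where
  "cycle_subgraphs k E =
     {F. \<exists>f. inj_on f {..<k} \<and> F = {{f i, f ((i + 1) mod k)} | i. i < k} \<and> F \<subseteq> E}"

definition num_cycles :: "nat \<Rightarrow> nat set set \<Rightarrow> nat" where
  "num_cycles k E = card (cycle_subgraphs k E)"

definition ex_bip_C6_C8 :: "nat \<Rightarrow> nat" where
  "ex_bip_C6_C8 n = Max {num_cycles 6 E | E. simple_graph_on n E \<and> bipartite E
                                              \<and> cycle_subgraphs 8 E = {}}"

end

theory Submission
  imports Defs "HOL-Analysis.Convex"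
begin

text \<open>
  Lower bound: the complete bipartite graph with parts of sizes 3 and n - 3 has no 8-cycle,
  since four of its vertices would lie in the part of size 3.

  Upper bound: let A, B be the parts. Call two vertices of the same part fat if they have at least
  four common neighbours and thin otherwise. Fat pairs can be replaced by paths of length two
  avoiding any three given vertices, so the fat graph on A has no 4-cycle, and it has no path on
  four vertices inside a neighbourhood. If the three A-vertices of a 6-cycle are pairwise fat, then
  they are determined by its three B-vertices; hence there are at most |B|^3 such cycles, at most
  |A|^3 with the parts exchanged, and |A|^3 + |B|^3 is at most n^3.

  For the other 6-cycles, let e be the number of edges. For a fixed vertex x, the edges between N(x)
  and A - {x} contain no path on eight vertices, so there are O(n) of them; this gives
  e = O(n^(3/2)). Inside each neighbourhood the fat graph has linearly many edges, so there are
  O(e) paths x y x' with x, x' fat. This bounds the 6-cycles with one or two thin pairs in A (or in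
  B) by O(n e). If all pairs are thin, fix x1, x2 in A: the paths of length four joining them
  pairwise share an inner vertex, so there are O(1 + d(x1) + d(x2)) of them; the sum over all
  x1, x2 is O(n^2 + n e).
\<close>

section \<open>Path-free graphs and counting by fibres\<close>

text \<open>Ordered pairs are counted, whence the factor 2. A vertex with fewer than
  \<open>k\<close> neighbours is deleted at a cost of at most \<open>2 * k\<close> pairs; if there
  is none, a path can be extended greedily at its head until it has \<open>k\<close>
  vertices.\<close>

lemma card_edges_le_of_no_path:
  assumes "finite V" and sym: "\<And>u v. R u v \<Longrightarrow> R v u"
    and nopath: "\<And>xs. \<lbrakk>length xs = k; distinct xs; set xs \<subseteq> V; successively R xs\<rbrakk> \<Longrightarrow> False"
  shows "card {(u, v). u \<in> V \<and> v \<in> V \<and> R u v} \<le> 2 * k * card V"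
  using assms(1) nopath
proof (induction V rule: finite_psubset_induct)
  case (psubset V)
  let ?nb = "\<lambda>v. {u \<in> V. R v u}"
  show ?case
  proof (cases "\<exists>v\<in>V. card (?nb v) < k")
    case True
    then obtain v where v: "v \<in> V" "card (?nb v) < k" by blast
    let ?W = "V - {v}"
    have IH: "card {(u, w). u \<in> ?W \<and> w \<in> ?W \<and> R u w} \<le> 2 * k * card ?W"
    proof (rule psubset.IH)
      show "?W \<subset> V" using v by blast
      show False if "length xs = k" "distinct xs" "set xs \<subseteq> ?W" "successively R xs" for xs
        using psubset.prems[of xs] that by blast
    qed
    have fin: "finite {(u, w). u \<in> ?W \<and> w \<in> ?W \<and> R u w}"
      by (rule finite_subset[of _ "V \<times> V"]) (use psubset.hyps in auto)
    have "{(u, w). u \<in> V \<and> w \<in> V \<and> R u w}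
        \<subseteq> {(u, w). u \<in> ?W \<and> w \<in> ?W \<and> R u w} \<union> ({v} \<times> ?nb v \<union> ?nb v \<times> {v})"
      using sym by blast
    then have "card {(u, w). u \<in> V \<and> w \<in> V \<and> R u w}
        \<le> card ({(u, w). u \<in> ?W \<and> w \<in> ?W \<and> R u w} \<union> ({v} \<times> ?nb v \<union> ?nb v \<times> {v}))"
      by (intro card_mono) (use fin psubset.hyps in auto)
    also have "\<dots> \<le> card {(u, w). u \<in> ?W \<and> w \<in> ?W \<and> R u w} + card ({v} \<times> ?nb v \<union> ?nb v \<times> {v})"
      by (rule card_Un_le)
    also have "card ({v} \<times> ?nb v \<union> ?nb v \<times> {v}) \<le> card ({v} \<times> ?nb v) + card (?nb v \<times> {v})"
      by (rule card_Un_le)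
    also have "\<dots> \<le> 2 * k" using v(2) by (simp add: card_cartesian_product)
    also have "card {(u, w). u \<in> ?W \<and> w \<in> ?W \<and> R u w} \<le> 2 * k * card ?W" by (rule IH)
    also have "2 * k * card ?W + 2 * k = 2 * k * card V"
      using v(1) psubset.hyps by (subst card.remove[of V v]) auto
    finally show ?thesis by simp
  next
    case False
    show ?thesis
    \<comment> \<open>For \<open>k = 0\<close> the empty list is already a forbidden path. Otherwise
      a vertex of \<open>V\<close> starts the greedy path, which is grown up to
      \<open>j = k - 1\<close>.\<close>
    proof (cases "V = {} \<or> k = 0")
      case True
      then show ?thesis using psubset.prems[of "[]"] by auto
    next
      case nonempty: False
      have "\<exists>xs. length xs = Suc j \<and> distinct xs \<and> set xs \<subseteq> V \<and> successively R xs" if "j < k" for j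
        using that
      proof (induction j)
        case 0
        obtain v where "v \<in> V" using nonempty by blast
        then show ?case by (intro exI[of _ "[v]"]) auto
      next
        case (Suc j)
        then obtain xs where xs: "length xs = Suc j" "distinct xs" "set xs \<subseteq> V" "successively R xs"
          by auto
        then obtain x ys where x: "xs = x # ys" by (cases xs) auto
        \<comment> \<open>The path has \<open>Suc j < k\<close> vertices while its head has at least
          \<open>k\<close> neighbours, so one of them is new.\<close>
        have "card (set xs) < card (?nb x)"
          using xs False Suc.prems x distinct_card[of xs] by fastforce
        then have "\<not> ?nb x \<subseteq> set xs" by (meson List.finite_set card_mono leD)
        then obtain u where "u \<in> V" "R x u" "u \<notin> set xs" by blast
        then show ?case using xs x sym by (intro exI[of _ "u # xs"]) auto
      qed
      from this[of "k - 1"] nonempty psubset.prems show ?thesis by fastforce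
    qed
  qed
qed

text \<open>Serves to count 6-cycles by projecting to some of their vertices: a fibre consists of
  the possible completions.\<close>

lemma card_le_sum_fibres:
  assumes "finite P" "p ` S \<subseteq> P" "\<And>q. q \<in> P \<Longrightarrow> finite {s \<in> S. p s = q}"
    and "\<And>q. q \<in> P \<Longrightarrow> card {s \<in> S. p s = q} \<le> g q"
  shows "card S \<le> (\<Sum>q\<in>P. g q)"
proof -
  have "S = (\<Union>q\<in>P. {s \<in> S. p s = q})" using assms(2) by auto
  then have "card S \<le> (\<Sum>q\<in>P. card {s \<in> S. p s = q})"
    using card_UN_le[OF assms(1), of "\<lambda>q. {s \<in> S. p s = q}"] by simp
  also have "\<dots> \<le> (\<Sum>q\<in>P. g q)" by (rule sum_mono) (rule assms(4))
  finally show ?thesis .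
qed

section \<open>Fat pairs and the types of 6-cycles\<close>

definition common :: "('a \<Rightarrow> 'b \<Rightarrow> bool) \<Rightarrow> 'a \<Rightarrow> 'a \<Rightarrow> 'b set" where
  "common r x x' = {y. r x y \<and> r x' y}"

text \<open>Among four common neighbours one survives the exclusion of any three, and no 8-cycle
  built below has to exclude more.\<close>

definition fat :: "('a \<Rightarrow> 'b \<Rightarrow> bool) \<Rightarrow> 'a \<Rightarrow> 'a \<Rightarrow> bool" where
  "fat r x x' \<longleftrightarrow> x \<noteq> x' \<and> 4 \<le> card (common r x x')"

text \<open>Labelled 6-cycles, in cyclic order \<open>x1 y1 x2 y2 x3 y3\<close>; the labels are
  forgotten later by \<open>hex_edges\<close>.\<close>

definition hexagon :: "('a \<Rightarrow> 'b \<Rightarrow> bool) \<Rightarrow> 'a \<Rightarrow> 'a \<Rightarrow> 'a \<Rightarrow> 'b \<Rightarrow> 'b \<Rightarrow> 'b \<Rightarrow> bool" where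
  "hexagon r x1 x2 x3 y1 y2 y3 \<longleftrightarrow> distinct [x1, x2, x3] \<and> distinct [y1, y2, y3] \<and>
     r x1 y1 \<and> r x2 y1 \<and> r x2 y2 \<and> r x3 y2 \<and> r x3 y3 \<and> r x1 y3"

definition fat_triangle :: "('a \<Rightarrow> 'b \<Rightarrow> bool) \<Rightarrow> 'a \<Rightarrow> 'a \<Rightarrow> 'a \<Rightarrow> bool" where
  "fat_triangle r x1 x2 x3 \<longleftrightarrow> fat r x1 x2 \<and> fat r x2 x3 \<and> fat r x1 x3"

text \<open>The position of the exceptional pair is fixed here and in \<open>two_thin\<close>; the
  other positions reduce to it by rotating the labels.\<close>

definition one_thin :: "('a \<Rightarrow> 'b \<Rightarrow> bool) \<Rightarrow> ('a \<times> 'a \<times> 'a \<times> 'b \<times> 'b \<times> 'b) set" where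
  "one_thin r = {(x1, x2, x3, y1, y2, y3). hexagon r x1 x2 x3 y1 y2 y3 \<and>
     \<not> fat r x1 x2 \<and> fat r x1 x3 \<and> fat r x2 x3}"

definition two_thin :: "('a \<Rightarrow> 'b \<Rightarrow> bool) \<Rightarrow> ('a \<times> 'a \<times> 'a \<times> 'b \<times> 'b \<times> 'b) set" where
  "two_thin r = {(x1, x2, x3, y1, y2, y3). hexagon r x1 x2 x3 y1 y2 y3 \<and>
     \<not> fat r x1 x2 \<and> \<not> fat r x1 x3 \<and> fat r x2 x3}"

text \<open>In the other part the condition is on \<open>y2\<close>, \<open>y3\<close>, the two
  inner vertices next to \<open>x3\<close> on the path \<open>x1 y3 x3 y2 x2\<close> that is
  counted.\<close>

definition all_thin :: "('a \<Rightarrow> 'b \<Rightarrow> bool) \<Rightarrow> ('a \<times> 'a \<times> 'a \<times> 'b \<times> 'b \<times> 'b) set" where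
  "all_thin r = {(x1, x2, x3, y1, y2, y3). hexagon r x1 x2 x3 y1 y2 y3 \<and>
     \<not> fat r x1 x2 \<and> \<not> fat r x1 x3 \<and> \<not> fat r x2 x3 \<and> \<not> fat (\<lambda>y x. r x y) y2 y3}"

text \<open>The order selects one of the six labellings of a 6-cycle. This class gives the leading
  term, so it must not be overcounted by a constant factor.\<close>

definition sorted_fat :: "('a :: linorder \<Rightarrow> 'b \<Rightarrow> bool) \<Rightarrow> ('a \<times> 'a \<times> 'a \<times> 'b \<times> 'b \<times> 'b) set" where
  "sorted_fat r = {(x1, x2, x3, y1, y2, y3). hexagon r x1 x2 x3 y1 y2 y3 \<and> fat_triangle r x1 x2 x3 \<and>
     x1 < x2 \<and> x2 < x3}"

lemma common_sym: "common r x x' = common r x' x"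
  by (auto simp: common_def)

lemma fat_sym: "fat r x x' \<Longrightarrow> fat r x' x"
  by (auto simp: fat_def common_sym)

lemma fat_avoid:
  assumes "fat r x x'" and "length ys \<le> 3"
  obtains c where "r x c" "r x' c" "c \<notin> set ys"
proof -
  have "card (set ys) < card (common r x x')"
    using assms card_length[of ys] by (auto simp: fat_def)
  then have "\<not> common r x x' \<subseteq> set ys" by (meson List.finite_set card_mono leD)
  then show ?thesis using that by (auto simp: common_def)
qed

section \<open>Bipartite graphs without 8-cycles\<close>

text \<open>The relation leads from one part to the other and the parts have separate types, so
  vertices of different parts need not be compared; \<open>dual\<close> exchanges the parts.\<close>

locale c8_free =
  fixes A :: "'a set" and B :: "'b set" and r :: "'a \<Rightarrow> 'b \<Rightarrow> bool"
  assumes finA: "finite A" and finB: "finite B"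
    and r_mem: "r x y \<Longrightarrow> x \<in> A" "r x y \<Longrightarrow> y \<in> B"
    and c8: "\<lbrakk>distinct [x1, x2, x3, x4]; distinct [y1, y2, y3, y4]; r x1 y1; r x2 y1; r x2 y2;
      r x3 y2; r x3 y3; r x4 y3; r x4 y4; r x1 y4\<rbrakk> \<Longrightarrow> False"
begin

definition N :: nat where "N = card A + card B"

definition edges :: nat where "edges = card {(x, y). r x y}"

definition fat_cherries :: "('a \<times> 'a \<times> 'b) set" where
  "fat_cherries = {(x, x', y). fat r x x' \<and> r x y \<and> r x' y}"

lemma dual: "c8_free B A (\<lambda>y x. r x y)"
proof
  fix y1 y2 y3 y4 :: 'b and x1 x2 x3 x4 :: 'a
  assume "distinct [y1, y2, y3, y4]" "distinct [x1, x2, x3, x4]" "r x1 y1" "r x1 y2" "r x2 y2"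
    "r x2 y3" "r x3 y3" "r x3 y4" "r x4 y4" "r x4 y1"
  \<comment> \<open>Here \<open>x1\<close> lies between \<open>y1\<close> and \<open>y2\<close>,
    whereas \<open>c8\<close> puts \<open>y1\<close> between \<open>x1\<close> and
    \<open>x2\<close>; hence the shift of the y-labels by one.\<close>
  then show False using c8[of x1 x2 x3 x4 y2 y3 y4 y1] by auto
qed (use finA finB r_mem in auto)

lemma finite_common: "finite (common r x x')"
  by (rule finite_subset[OF _ finB]) (auto simp: common_def dest: r_mem)

lemma card_common_le: "\<not> fat r x x' \<Longrightarrow> x \<noteq> x' \<Longrightarrow> card (common r x x') \<le> 3"
  by (auto simp: fat_def)

lemma finite_nbs: "finite {y. r x y}" "finite {x. r x y}"
  by (rule finite_subset[OF _ finB], use r_mem in blast)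
    (rule finite_subset[OF _ finA], use r_mem in blast)

lemma edges_eq_sum: "edges = (\<Sum>x\<in>A. card {y. r x y})" "edges = (\<Sum>y\<in>B. card {x. r x y})"
proof -
  have "{(x, y). r x y} = (SIGMA x:A. {y. r x y})" using r_mem by auto
  then show "edges = (\<Sum>x\<in>A. card {y. r x y})"
    unfolding edges_def using finA finite_nbs by simp
  have "{(x, y). r x y} = prod.swap ` (SIGMA y:B. {x. r x y})" using r_mem by auto
  then have "edges = card (SIGMA y:B. {x. r x y})"
    unfolding edges_def by (simp add: card_image)
  then show "edges = (\<Sum>y\<in>B. card {x. r x y})" using finB finite_nbs by simp
qed

section \<open>Forbidden configurations of fat pairs\<close>

text \<open>Replacing the four fat pairs one after the other by paths of length two with new centres
  gives an 8-cycle.\<close>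

lemma no_fat_C4:
  assumes "fat r x1 x2" "fat r x2 x3" "fat r x3 x4" "fat r x4 x1" "distinct [x1, x2, x3, x4]"
  shows False
proof -
  obtain a where a: "r x1 a" "r x2 a" using fat_avoid[OF assms(1), of "[]"] by auto
  obtain b where b: "r x2 b" "r x3 b" "b \<notin> set [a]" using fat_avoid[OF assms(2), of "[a]"] by auto
  obtain c where c: "r x3 c" "r x4 c" "c \<notin> set [a, b]"
    using fat_avoid[OF assms(3), of "[a, b]"] by auto
  obtain d where d: "r x4 d" "r x1 d" "d \<notin> set [a, b, c]"
    using fat_avoid[OF assms(4), of "[a, b, c]"] by auto
  show False using c8[of x1 x2 x3 x4 a b c d] a b c d assms(5) by auto
qed

text \<open>As for the fat 4-cycle, with \<open>y\<close> as the centre of the closing path; the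
  other three centres must avoid it.\<close>

lemma no_fat_P4:
  assumes "fat r x1 x2" "fat r x2 x3" "fat r x3 x4" "distinct [x1, x2, x3, x4]" "r x1 y" "r x4 y"
  shows False
proof -
  obtain a where a: "r x1 a" "r x2 a" "a \<notin> set [y]" using fat_avoid[OF assms(1), of "[y]"] by auto
  obtain b where b: "r x2 b" "r x3 b" "b \<notin> set [y, a]"
    using fat_avoid[OF assms(2), of "[y, a]"] by auto
  obtain c where c: "r x3 c" "r x4 c" "c \<notin> set [y, a, b]"
    using fat_avoid[OF assms(3), of "[y, a, b]"] by auto
  show False using c8[of x1 x2 x3 x4 a b c y] a b c assms by auto
qed

text \<open>With centres \<open>a\<close>, \<open>b\<close> chosen for the two fat pairs,
  \<open>p a q y' q' b p' y\<close> is an 8-cycle.\<close>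

lemma no_two_fat_links:
  assumes "fat r p q" "fat r p' q'" "distinct [p, q, p', q']" "y \<noteq> y'"
    "r p y" "r p' y" "r q y'" "r q' y'"
  shows False
proof -
  obtain a where a: "r p a" "r q a" "a \<notin> set [y, y']"
    using fat_avoid[OF assms(1), of "[y, y']"] by auto
  obtain b where b: "r p' b" "r q' b" "b \<notin> set [y, y', a]"
    using fat_avoid[OF assms(2), of "[y, y', a]"] by auto
  show False using c8[of p q q' p' a y' b y] a b assms by auto
qed

section \<open>Paths of length two and the number of edges\<close>

text \<open>The pairs are the edges between N(x) and \<open>A - {x}\<close>. A path on seven
  vertices with both ends in N(x) would be closed by \<open>x\<close> to an 8-cycle, and every path
  on eight vertices contains such a path. The constant is \<open>2 * 8\<close>.\<close>

lemma card_cherries_at_le: "card {(x', y). x' \<noteq> x \<and> r x y \<and> r x' y} \<le> 16 * N"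
proof -
  define V where "V = Inl ` A \<union> Inr ` B"
  define R where "R u v \<longleftrightarrow> (\<exists>x' y. x' \<noteq> x \<and> r x y \<and> r x' y \<and>
    (u = Inl x' \<and> v = Inr y \<or> u = Inr y \<and> v = Inl x'))" for u v :: "'a + 'b"
  have R_simps: "R (Inl a) (Inr b) \<longleftrightarrow> a \<noteq> x \<and> r x b \<and> r a b"
    "R (Inr b) (Inl a) \<longleftrightarrow> a \<noteq> x \<and> r x b \<and> r a b"
    "\<not> R (Inl a) (Inl a')" "\<not> R (Inr b) (Inr b')" for a a' b b'
    by (auto simp: R_def)
  have noP7: False if "distinct [y1, y2, y3, y4]" "distinct [x1, x2, x3]"
    "x1 \<noteq> x" "x2 \<noteq> x" "x3 \<noteq> x" "r x y1" "r x y4" "r x1 y1" "r x1 y2" "r x2 y2" "r x2 y3"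
    "r x3 y3" "r x3 y4" for y1 y2 y3 y4 x1 x2 x3
    using c8[of x x1 x2 x3 y1 y2 y3 y4] that by auto
  have "card {(u, v). u \<in> V \<and> v \<in> V \<and> R u v} \<le> 2 * 8 * card V"
  proof (rule card_edges_le_of_no_path)
    show "finite V" by (simp add: V_def finA finB)
    show "R v u" if "R u v" for u v using that by (auto simp: R_def)
    show False if len: "length xs = 8" and xs: "distinct xs" "set xs \<subseteq> V" "successively R xs" for xs
    proof -
      obtain a b c d e f g h where eq: "xs = [a, b, c, d, e, f, g, h]"
        using len by (auto simp: length_Suc_conv numeral_eq_Suc)
      show False
      \<comment> \<open>The path alternates between the parts: if it starts in \<open>A\<close> its
        first vertex is dropped, otherwise its last, leaving seven vertices with both ends in
        N(x).\<close>
      proof (cases a)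
        case (Inl a')
        obtain b' where b: "b = Inr b'" using xs eq Inl by (cases b) (simp_all add: R_simps)
        obtain c' where c: "c = Inl c'" using xs eq b by (cases c) (simp_all add: R_simps)
        obtain d' where d: "d = Inr d'" using xs eq c by (cases d) (simp_all add: R_simps)
        obtain e' where e: "e = Inl e'" using xs eq d by (cases e) (simp_all add: R_simps)
        obtain f' where f: "f = Inr f'" using xs eq e by (cases f) (simp_all add: R_simps)
        obtain g' where g: "g = Inl g'" using xs eq f by (cases g) (simp_all add: R_simps)
        obtain h' where h: "h = Inr h'" using xs eq g by (cases h) (simp_all add: R_simps)
        show False using noP7[of b' d' f' h' c' e' g'] xs eq Inl b c d e f g h
          by (simp add: R_simps)
      next
        case (Inr a')
        obtain b' where b: "b = Inl b'" using xs eq Inr by (cases b) (simp_all add: R_simps)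
        obtain c' where c: "c = Inr c'" using xs eq b by (cases c) (simp_all add: R_simps)
        obtain d' where d: "d = Inl d'" using xs eq c by (cases d) (simp_all add: R_simps)
        obtain e' where e: "e = Inr e'" using xs eq d by (cases e) (simp_all add: R_simps)
        obtain f' where f: "f = Inl f'" using xs eq e by (cases f) (simp_all add: R_simps)
        obtain g' where g: "g = Inr g'" using xs eq f by (cases g) (simp_all add: R_simps)
        show False using noP7[of a' c' e' g' b' d' f'] xs eq Inr b c d e f g
          by (simp add: R_simps)
      qed
    qed
  qed
  moreover have "card V = N"
    unfolding V_def N_def using finA finB
    by (subst card_Un_disjoint) (auto simp: card_image)
  moreover have "card {(x', y). x' \<noteq> x \<and> r x y \<and> r x' y} \<le> card {(u, v). u \<in> V \<and> v \<in> V \<and> R u v}"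
  proof (rule card_inj_on_le)
    show "inj_on (\<lambda>(x', y). (Inl x', Inr y)) {(x', y). x' \<noteq> x \<and> r x y \<and> r x' y}"
      by (auto simp: inj_on_def)
    show "(\<lambda>(x', y). (Inl x', Inr y)) ` {(x', y). x' \<noteq> x \<and> r x y \<and> r x' y}
        \<subseteq> {(u, v). u \<in> V \<and> v \<in> V \<and> R u v}"
      by (auto simp: V_def R_simps dest: r_mem)
    show "finite {(u, v). u \<in> V \<and> v \<in> V \<and> R u v}"
      by (rule finite_subset[of _ "V \<times> V"]) (auto simp: V_def finA finB)
  qed
  ultimately show ?thesis by simp
qed

lemma card_all_cherries_at_le: "card {(x', y). r x y \<and> r x' y} \<le> 17 * N"
proof -
  have "{(x', y). r x y \<and> r x' y} \<subseteq> {(x', y). x' \<noteq> x \<and> r x y \<and> r x' y} \<union> {x} \<times> B"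
    using r_mem by auto
  moreover have "finite ({(x', y). x' \<noteq> x \<and> r x y \<and> r x' y} \<union> {x} \<times> B)"
    by (rule finite_subset[of _ "A \<times> B \<union> {x} \<times> B"]) (auto simp: finA finB dest: r_mem)
  ultimately have "card {(x', y). r x y \<and> r x' y}
      \<le> card ({(x', y). x' \<noteq> x \<and> r x y \<and> r x' y} \<union> {x} \<times> B)"
    by (rule card_mono[rotated])
  also have "\<dots> \<le> card {(x', y). x' \<noteq> x \<and> r x y \<and> r x' y} + card ({x} \<times> B)" by (rule card_Un_le)
  also have "\<dots> \<le> 16 * N + N"
    using card_cherries_at_le[of x] by (intro add_mono) (auto simp: N_def card_cartesian_product)
  finally show ?thesis by simp
qed

text \<open>Cauchy-Schwarz for the degrees in \<open>B\<close>: their squares sum to the number of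
  walks \<open>x y x'\<close>, of which at most \<open>17 * N\<close> start at each
  \<open>x\<close>.\<close>

lemma edges_square_le: "edges\<^sup>2 \<le> 17 * N ^ 3"
proof -
  let ?d = "\<lambda>y. card {x. r x y}"
  have "(\<Sum>y\<in>B. (?d y)\<^sup>2) = card (SIGMA y:B. {x. r x y} \<times> {x. r x y})"
    using finB finite_nbs by (simp add: card_cartesian_product power2_eq_square)
  also have "(SIGMA y:B. {x. r x y} \<times> {x. r x y}) =
     (\<lambda>(x, x', y). (y, x, x')) ` (SIGMA x:A. {(x', y). r x y \<and> r x' y})"
    using r_mem by (auto simp: image_iff)
  also have "card \<dots> = card (SIGMA x:A. {(x', y). r x y \<and> r x' y})"
    by (rule card_image) (auto simp: inj_on_def)
  also have "\<dots> = (\<Sum>x\<in>A. card {(x', y). r x y \<and> r x' y})"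
  proof (rule card_SigmaI)
    show "\<forall>a\<in>A. finite {(x', y). r a y \<and> r x' y}"
      by (rule ballI, rule finite_subset[of _ "A \<times> B"]) (auto simp: finA finB dest: r_mem)
  qed (rule finA)
  also have "\<dots> \<le> (\<Sum>x\<in>A. 17 * N)" by (rule sum_mono) (rule card_all_cherries_at_le)
  also have "\<dots> \<le> 17 * N\<^sup>2" by (simp add: N_def power2_eq_square algebra_simps)
  finally have sq: "(\<Sum>y\<in>B. (?d y)\<^sup>2) \<le> 17 * N\<^sup>2" .
  have "real (edges\<^sup>2) = (\<Sum>y\<in>B. 1 * real (?d y))\<^sup>2" by (simp add: edges_eq_sum(2))
  also have "\<dots> \<le> (\<Sum>y\<in>B. 1\<^sup>2) * (\<Sum>y\<in>B. (real (?d y))\<^sup>2)" by (rule Cauchy_Schwarz_ineq_sum)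
  also have "\<dots> = real (card B * (\<Sum>y\<in>B. (?d y)\<^sup>2))" by simp
  finally have "edges\<^sup>2 \<le> card B * (\<Sum>y\<in>B. (?d y)\<^sup>2)" by (simp only: of_nat_le_iff)
  also have "\<dots> \<le> N * (17 * N\<^sup>2)" using sq by (intro mult_mono) (auto simp: N_def)
  finally show ?thesis by (simp add: power2_eq_square power3_eq_cube)
qed

lemma finite_fat_cherries: "finite fat_cherries"
  by (rule finite_subset[of _ "A \<times> A \<times> B"]) (auto simp: fat_cherries_def finA finB dest: r_mem)

text \<open>By \<open>no_fat_P4\<close> the fat graph inside the neighbourhood of \<open>y\<close>
  has no path on four vertices, so it has at most \<open>2 * 4\<close> ordered pairs per neighbour;
  the degrees then sum to \<open>edges\<close>.\<close>

lemma card_fat_cherries_le: "card fat_cherries \<le> 8 * edges"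
proof -
  have "card fat_cherries \<le> (\<Sum>y\<in>B. 8 * card {x. r x y})"
  proof (rule card_le_sum_fibres[where p = "\<lambda>(x, x', y). y"])
    fix y
    let ?V = "{x. r x y}"
    have "card {s \<in> fat_cherries. (case s of (x, x', y) \<Rightarrow> y) = y}
        = card {(u, v). u \<in> ?V \<and> v \<in> ?V \<and> fat r u v}"
      by (rule bij_betw_same_card[where f = "\<lambda>(x, x', y). (x, x')"])
        (auto simp: bij_betw_def inj_on_def fat_cherries_def image_iff)
    also have "\<dots> \<le> 2 * 4 * card ?V"
    proof (rule card_edges_le_of_no_path)
      show False if len: "length xs = 4" and xs: "distinct xs" "set xs \<subseteq> ?V" "successively (fat r) xs"
        for xs
      proof -
        obtain a b c d where eq: "xs = [a, b, c, d]"
          using len by (auto simp: length_Suc_conv numeral_eq_Suc)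
        with xs show False using no_fat_P4[of a b c d y] by auto
      qed
    qed (auto intro: finite_nbs fat_sym)
    finally show "card {s \<in> fat_cherries. (case s of (x, x', y) \<Rightarrow> y) = y} \<le> 8 * card ?V" by simp
    show "finite {s \<in> fat_cherries. (case s of (x, x', y) \<Rightarrow> y) = y}"
      by (rule finite_subset[OF _ finite_fat_cherries]) auto
  qed (use finB r_mem in \<open>auto simp: fat_cherries_def\<close>)
  also have "\<dots> = 8 * edges" by (simp add: edges_eq_sum(2) sum_distrib_left)
  finally show ?thesis .
qed

section \<open>Uniqueness of fat triangles\<close>

lemma hexagon_mem:
  assumes "hexagon r x1 x2 x3 y1 y2 y3"
  shows "x1 \<in> A" "x2 \<in> A" "x3 \<in> A" "y1 \<in> B" "y2 \<in> B" "y3 \<in> B"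
  using assms r_mem by (auto simp: hexagon_def)

lemma finite_hexagons: "finite {(x1, x2, x3, y1, y2, y3). hexagon r x1 x2 x3 y1 y2 y3}"
  by (rule finite_subset[of _ "A \<times> A \<times> A \<times> B \<times> B \<times> B"])
    (use hexagon_mem in \<open>auto simp: finA finB\<close>)

text \<open>If different triangles share two vertices \<open>u\<close>, \<open>v\<close>, then these
  and one private vertex of each triangle form a fat 4-cycle. If they share at most one vertex
  \<open>z\<close>, the remaining vertices provide disjoint fat pairs, both linking
  \<open>y1\<close> to \<open>y2\<close>, against \<open>no_two_fat_links\<close>.\<close>

lemma fat_triangle_unique:
  assumes h: "hexagon r x1 x2 x3 y1 y2 y3" "hexagon r x1' x2' x3' y1 y2 y3"
    and f: "fat_triangle r x1 x2 x3" "fat_triangle r x1' x2' x3'"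
  shows "{x1, x2, x3} = {x1', x2', x3'}"
proof (rule ccontr)
  let ?T = "{x1, x2, x3}" and ?T' = "{x1', x2', x3'}"
  assume ne: "?T \<noteq> ?T'"
  have card: "card ?T = 3" "card ?T' = 3" using h by (auto simp: hexagon_def)
  have fatT: "fat r u v" if "u \<in> ?T" "v \<in> ?T" "u \<noteq> v" for u v
    using that f(1) fat_sym[of r] by (auto simp: fat_triangle_def)
  have fatT': "fat r u v" if "u \<in> ?T'" "v \<in> ?T'" "u \<noteq> v" for u v
    using that f(2) fat_sym[of r] by (auto simp: fat_triangle_def)
  have "\<exists>z. ?T \<inter> ?T' \<subseteq> {z}"
  proof (rule ccontr)
    assume "\<nexists>z. ?T \<inter> ?T' \<subseteq> {z}"
    then obtain u v where uv: "u \<in> ?T \<inter> ?T'" "v \<in> ?T \<inter> ?T'" "u \<noteq> v" by blast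
    obtain s where s: "s \<in> ?T" "s \<notin> ?T'"
      using ne card card_subset_eq[of ?T' ?T] by (metis finite.emptyI finite.insertI subsetI)
    obtain t where t: "t \<in> ?T'" "t \<notin> ?T"
      using ne card card_subset_eq[of ?T ?T'] by (metis finite.emptyI finite.insertI subsetI)
    have "u \<noteq> s" "u \<noteq> t" "v \<noteq> s" "v \<noteq> t" "s \<noteq> t" using uv s t by blast+
    then show False
      using no_fat_C4[of u s v t] fatT[of u s] fatT[of s v] fatT'[of v t] fatT'[of t u] uv s t
      by simp
  qed
  then obtain z where z: "?T \<inter> ?T' \<subseteq> {z}" by blast
  \<comment> \<open>Whichever vertex is removed from the triangle, the two that remain can be
    matched to \<open>y1\<close> and \<open>y2\<close> along edges of the hexagon.\<close>
  obtain p q where p: "p \<in> ?T" "q \<in> ?T" "p \<noteq> z" "q \<noteq> z" "p \<noteq> q" "r p y1" "r q y2"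
    using h(1) by (cases "z = x1"; cases "z = x2") (auto simp: hexagon_def)
  obtain p' q' where p': "p' \<in> ?T'" "q' \<in> ?T'" "p' \<noteq> z" "q' \<noteq> z" "p' \<noteq> q'" "r p' y1" "r q' y2"
    using h(2) by (cases "z = x1'"; cases "z = x2'") (auto simp: hexagon_def)
  have "p \<noteq> p'" "p \<noteq> q'" "q \<noteq> p'" "q \<noteq> q'" using p p' z by blast+
  moreover have "y1 \<noteq> y2" using h(1) by (auto simp: hexagon_def)
  ultimately show False
    using no_two_fat_links[of p q p' q' y1 y2] fatT[of p q] fatT'[of p' q'] p p' by simp
qed

section \<open>6-cycles with thin pairs\<close>

lemma finite_thin: "finite (one_thin r)" "finite (two_thin r)" "finite (all_thin r)"
  by (rule finite_subset[OF _ finite_hexagons]; force simp: one_thin_def two_thin_def all_thin_def)+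

text \<open>The two fat pairs meet in \<open>x3\<close>. Given the paths \<open>x3 y3 x1\<close> and
  \<open>x3 y2 x2\<close>, the thin pair \<open>x1\<close>, \<open>x2\<close> leaves at most 3
  choices of \<open>y1\<close>. One factor \<open>card (f x3)\<close> is bounded by
  \<open>16 * N\<close>, the other is summed to \<open>8 * edges\<close>;
  \<open>384 = 3 * 16 * 8\<close>.\<close>

lemma card_one_thin_le: "card (one_thin r) \<le> 384 * N * edges"
proof -
  define f where "f x = {(x', y). fat r x x' \<and> r x y \<and> r x' y}" for x
  have fin: "finite (f x)" for x
    by (rule finite_subset[of _ "A \<times> B"]) (auto simp: f_def finA finB dest: r_mem)
  have f_le: "card (f x) \<le> 16 * N" for x
  proof -
    have "card (f x) \<le> card {(x', y). x' \<noteq> x \<and> r x y \<and> r x' y}"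
    proof (rule card_mono)
      show "finite {(x', y). x' \<noteq> x \<and> r x y \<and> r x' y}"
        by (rule finite_subset[of _ "A \<times> B"]) (auto simp: finA finB dest: r_mem)
    qed (auto simp: f_def fat_def)
    then show ?thesis using card_cherries_at_le[of x] by simp
  qed
  have sum_f: "(\<Sum>x\<in>A. card (f x)) \<le> 8 * edges"
  proof -
    have "(SIGMA x:A. f x) = fat_cherries"
      by (auto simp: f_def fat_cherries_def dest: r_mem)
    then have "(\<Sum>x\<in>A. card (f x)) = card fat_cherries"
      using card_SigmaI[of A f] finA fin by simp
    then show ?thesis using card_fat_cherries_le by simp
  qed
  let ?P = "SIGMA x:A. f x \<times> f x"
  have "card (one_thin r) \<le> (\<Sum>q\<in>?P. 3)"
  proof (rule card_le_sum_fibres[where p = "\<lambda>(x1, x2, x3, y1, y2, y3). (x3, (x1, y3), (x2, y2))"])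
    show "finite ?P" using finA fin by simp
    show "(\<lambda>(x1, x2, x3, y1, y2, y3). (x3, (x1, y3), (x2, y2))) ` one_thin r \<subseteq> ?P"
      using r_mem by (auto simp: one_thin_def hexagon_def f_def intro: fat_sym)
    fix q :: "'a \<times> ('a \<times> 'b) \<times> ('a \<times> 'b)"
    obtain x1 x2 x3 y2 y3 where q: "q = (x3, (x1, y3), (x2, y2))" by (metis prod.exhaust)
    let ?S = "{s \<in> one_thin r. (case s of (x1, x2, x3, y1, y2, y3) \<Rightarrow> (x3, (x1, y3), (x2, y2))) = q}"
    show "finite ?S" by (rule finite_subset[OF _ finite_thin(1)]) auto
    show "card ?S \<le> 3"
    proof (cases "\<not> fat r x1 x2 \<and> x1 \<noteq> x2")
      case True
      have "?S \<subseteq> (\<lambda>y1. (x1, x2, x3, y1, y2, y3)) ` common r x1 x2"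
        by (auto simp: q one_thin_def hexagon_def common_def)
      then have "card ?S \<le> card (common r x1 x2)" by (rule surj_card_le[OF finite_common])
      then show ?thesis using True card_common_le[of x1 x2] by simp
    next
      case False
      then have "?S = {}" by (auto simp: q one_thin_def hexagon_def)
      then show ?thesis by (simp only: card.empty)
    qed
  qed
  also have "\<dots> = 3 * (\<Sum>x\<in>A. card (f x) * card (f x))"
    using finA fin by (simp add: card_cartesian_product)
  also have "\<dots> \<le> 3 * (\<Sum>x\<in>A. 16 * N * card (f x))"
    by (intro mult_left_mono sum_mono mult_right_mono f_le) auto
  also have "\<dots> = 48 * N * (\<Sum>x\<in>A. card (f x))" by (simp add: sum_distrib_left mult.assoc)
  also have "\<dots> \<le> 48 * N * (8 * edges)" by (intro mult_left_mono sum_f) auto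
  finally show ?thesis by (simp add: mult.commute mult.left_commute)
qed

text \<open>Choose \<open>x1\<close> freely and a path \<open>x2 y2 x3\<close> with fat ends; each
  of \<open>y1\<close>, \<open>y3\<close> is then one of at most 3 common neighbours of a thin pair.
  This gives \<open>72 = 3 * 3 * 8\<close>.\<close>

lemma card_two_thin_le: "card (two_thin r) \<le> 72 * N * edges"
proof -
  let ?P = "A \<times> fat_cherries"
  have "card (two_thin r) \<le> (\<Sum>q\<in>?P. 9)"
  proof (rule card_le_sum_fibres[where p = "\<lambda>(x1, x2, x3, y1, y2, y3). (x1, x2, x3, y2)"])
    show "finite ?P" using finA finite_fat_cherries by simp
    show "(\<lambda>(x1, x2, x3, y1, y2, y3). (x1, x2, x3, y2)) ` two_thin r \<subseteq> ?P"
      using r_mem by (auto simp: two_thin_def hexagon_def fat_cherries_def)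
    fix q :: "'a \<times> 'a \<times> 'a \<times> 'b"
    obtain x1 x2 x3 y2 where q: "q = (x1, x2, x3, y2)" by (metis prod.exhaust)
    let ?S = "{s \<in> two_thin r. (case s of (x1, x2, x3, y1, y2, y3) \<Rightarrow> (x1, x2, x3, y2)) = q}"
    show "finite ?S" by (rule finite_subset[OF _ finite_thin(2)]) auto
    show "card ?S \<le> 9"
    proof (cases "\<not> fat r x1 x2 \<and> x1 \<noteq> x2 \<and> \<not> fat r x1 x3 \<and> x1 \<noteq> x3")
      case True
      have "?S \<subseteq> (\<lambda>(y1, y3). (x1, x2, x3, y1, y2, y3)) ` (common r x1 x2 \<times> common r x1 x3)"
        by (auto simp: q two_thin_def hexagon_def common_def)
      then have "card ?S \<le> card (common r x1 x2 \<times> common r x1 x3)"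
        by (rule surj_card_le[rotated]) (simp add: finite_common)
      also have "\<dots> \<le> 3 * 3"
        unfolding card_cartesian_product using True by (intro mult_mono card_common_le) auto
      finally show ?thesis by simp
    next
      case False
      then have "?S = {}" by (auto simp: q two_thin_def hexagon_def)
      then show ?thesis by (simp only: card.empty)
    qed
  qed
  also have "\<dots> = 9 * card A * card fat_cherries" by (simp add: card_cartesian_product)
  also have "\<dots> \<le> 9 * N * (8 * edges)"
    using card_fat_cherries_le by (intro mult_mono) (auto simp: N_def)
  finally show ?thesis by simp
qed

text \<open>Any two of these paths of length four from x1 to x2 share an inner vertex,
  since otherwise they would form an 8-cycle.\<close>
lemma card_thin_paths_le:
  assumes "x1 \<noteq> x2"
  defines "S \<equiv> {(y3, x3, y2). distinct [x1, x2, x3] \<and> y2 \<noteq> y3 \<and> r x2 y2 \<and> r x3 y2 \<and> r x3 y3 \<and> r x1 y3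
     \<and> \<not> fat r x1 x3 \<and> \<not> fat r x2 x3 \<and> \<not> fat (\<lambda>y x. r x y) y2 y3}"
  shows "card S \<le> 9 + 6 * card {y. r x1 y} + 6 * card {y. r x2 y}"
proof (cases "S = {}")
  case True
  then show ?thesis by simp
next
  case False
  then obtain b c a where star: "(b, c, a) \<in> S" by (metis ex_in_conv prod.exhaust)
  interpret d: c8_free B A "\<lambda>y x. r x y" by (rule dual)
  let ?com = "common (\<lambda>y x. r x y)"
  \<comment> \<open>One path \<open>x1 b c a x2\<close> is fixed. \<open>?S0\<close> takes the paths
    through \<open>c\<close>, \<open>?SL u\<close> those with \<open>y3 = u\<close>,
    \<open>?SR u\<close> those with \<open>y2 = u\<close>. Omitting \<open>u\<close> and emptying
    the fibres over fat pairs ensures that every fibre has at most 3 elements.\<close>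
  let ?S0 = "(\<lambda>(y3, y2). (y3, c, y2)) ` (common r x1 c \<times> common r x2 c)"
  let ?SL = "\<lambda>u. (\<lambda>(y2, x3). (u, x3, y2)) `
    (SIGMA y2:{y. r x2 y} - {u}. if fat (\<lambda>y x. r x y) y2 u then {} else ?com y2 u)"
  let ?SR = "\<lambda>u. (\<lambda>(y3, x3). (y3, x3, u)) `
    (SIGMA y3:{y. r x1 y} - {u}. if fat (\<lambda>y x. r x y) u y3 then {} else ?com u y3)"
  have sub: "S \<subseteq> ?S0 \<union> ((?SL b \<union> ?SL a) \<union> (?SR b \<union> ?SR a))"
  proof
    fix s assume s: "s \<in> S"
    obtain y3 x3 y2 where eq: "s = (y3, x3, y2)" by (metis prod.exhaust)
    have "x3 = c \<or> y3 = b \<or> y3 = a \<or> y2 = b \<or> y2 = a"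
    proof (rule ccontr)
      assume "\<not> ?thesis"
      then show False
        using c8[of x1 x3 x2 c y3 y2 a b] s star eq assms(1) by (auto simp: S_def)
    qed
    then consider "x3 = c" | "y3 = b" | "y3 = a" | "y2 = b" | "y2 = a" by blast
    then show "s \<in> ?S0 \<union> ((?SL b \<union> ?SL a) \<union> (?SR b \<union> ?SR a))"
    proof cases
      case 1
      then have "s \<in> ?S0" using s eq by (force simp: S_def common_def)
      then show ?thesis by blast
    next
      case 2
      then have "s \<in> ?SL b" using s eq by (force simp: S_def common_def)
      then show ?thesis by blast
    next
      case 3
      then have "s \<in> ?SL a" using s eq by (force simp: S_def common_def)
      then show ?thesis by blast
    next
      case 4
      then have "s \<in> ?SR b" using s eq by (force simp: S_def common_def)
      then show ?thesis by blast
    next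
      case 5
      then have "s \<in> ?SR a" using s eq by (force simp: S_def common_def)
      then show ?thesis by blast
    qed
  qed
  have fin0: "finite ?S0" by (intro finite_imageI finite_cartesian_product finite_common)
  have finL: "finite (?SL u)" for u
    by (intro finite_imageI finite_SigmaI) (auto simp: finite_nbs d.finite_common)
  have finR: "finite (?SR u)" for u
    by (intro finite_imageI finite_SigmaI) (auto simp: finite_nbs d.finite_common)
  have "card ?S0 \<le> card (common r x1 c \<times> common r x2 c)"
    by (intro card_image_le finite_cartesian_product finite_common)
  also have "\<dots> \<le> 3 * 3"
    unfolding card_cartesian_product using star
    by (intro mult_mono card_common_le) (auto simp: S_def)
  finally have c0: "card ?S0 \<le> 9" by simp
  have cL: "card (?SL u) \<le> 3 * card {y. r x2 y}" for u
  proof -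
    have "card (?SL u) \<le> card (SIGMA y2:{y. r x2 y} - {u}. if fat (\<lambda>y x. r x y) y2 u then {} else ?com y2 u)"
      by (intro card_image_le finite_SigmaI) (auto simp: finite_nbs d.finite_common)
    also have "\<dots> = (\<Sum>y2\<in>{y. r x2 y} - {u}. card (if fat (\<lambda>y x. r x y) y2 u then {} else ?com y2 u))"
      by (rule card_SigmaI) (auto simp: finite_nbs d.finite_common)
    also have "\<dots> \<le> (\<Sum>y2\<in>{y. r x2 y} - {u}. 3)"
      by (rule sum_mono) (auto intro: d.card_common_le)
    also have "\<dots> \<le> 3 * card {y. r x2 y}"
      by (simp add: card_Diff1_le)
    finally show ?thesis .
  qed
  have cR: "card (?SR u) \<le> 3 * card {y. r x1 y}" for u
  proof -
    have "card (?SR u) \<le> card (SIGMA y3:{y. r x1 y} - {u}. if fat (\<lambda>y x. r x y) u y3 then {} else ?com u y3)"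
      by (intro card_image_le finite_SigmaI) (auto simp: finite_nbs d.finite_common)
    also have "\<dots> = (\<Sum>y3\<in>{y. r x1 y} - {u}. card (if fat (\<lambda>y x. r x y) u y3 then {} else ?com u y3))"
      by (rule card_SigmaI) (auto simp: finite_nbs d.finite_common)
    also have "\<dots> \<le> (\<Sum>y3\<in>{y. r x1 y} - {u}. 3)"
      by (rule sum_mono) (auto intro: d.card_common_le)
    also have "\<dots> \<le> 3 * card {y. r x1 y}"
      by (simp add: card_Diff1_le)
    finally show ?thesis .
  qed
  have "card S \<le> card (?S0 \<union> ((?SL b \<union> ?SL a) \<union> (?SR b \<union> ?SR a)))"
    by (intro card_mono sub finite_UnI fin0 finL finR)
  also have "\<dots> \<le> card ?S0 + ((card (?SL b) + card (?SL a)) + (card (?SR b) + card (?SR a)))"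
    by (intro order_trans[OF card_Un_le] add_mono order_refl)
  also have "\<dots> \<le> 9 + ((3 * card {y. r x2 y} + 3 * card {y. r x2 y}) + (3 * card {y. r x1 y} + 3 * card {y. r x1 y}))"
    by (intro add_mono c0 cL cR)
  finally show ?thesis by simp
qed

text \<open>For each ordered pair \<open>x1\<close>, \<open>x2\<close> there are at most 3 choices
  of \<open>y1\<close>, and \<open>card_thin_paths_le\<close> bounds the rest of the cycle. Summed
  over all pairs, each of the two degree terms contributes
  \<open>18 * card A * edges\<close>.\<close>

lemma card_all_thin_le: "card (all_thin r) \<le> 27 * N\<^sup>2 + 36 * N * edges"
proof -
  let ?d = "\<lambda>x. card {y. r x y}"
  have "card (all_thin r) \<le> (\<Sum>q\<in>A \<times> A. 3 * (9 + 6 * ?d (fst q) + 6 * ?d (snd q)))"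
  proof (rule card_le_sum_fibres[where p = "\<lambda>(x1, x2, x3, y1, y2, y3). (x1, x2)"])
    show "finite (A \<times> A)" using finA by simp
    show "(\<lambda>(x1, x2, x3, y1, y2, y3). (x1, x2)) ` all_thin r \<subseteq> A \<times> A"
      using r_mem by (auto simp: all_thin_def hexagon_def)
    fix q :: "'a \<times> 'a"
    obtain x1 x2 where q: "q = (x1, x2)" by (metis prod.exhaust)
    let ?F = "{s \<in> all_thin r. (case s of (x1, x2, x3, y1, y2, y3) \<Rightarrow> (x1, x2)) = q}"
    show "finite ?F" by (rule finite_subset[OF _ finite_thin(3)]) auto
    show "card ?F \<le> 3 * (9 + 6 * ?d (fst q) + 6 * ?d (snd q))"
    proof (cases "\<not> fat r x1 x2 \<and> x1 \<noteq> x2")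
      case True
      let ?S = "{(y3, x3, y2). distinct [x1, x2, x3] \<and> y2 \<noteq> y3 \<and> r x2 y2 \<and> r x3 y2 \<and> r x3 y3 \<and> r x1 y3
         \<and> \<not> fat r x1 x3 \<and> \<not> fat r x2 x3 \<and> \<not> fat (\<lambda>y x. r x y) y2 y3}"
      have finS: "finite ?S"
        by (rule finite_subset[of _ "B \<times> A \<times> B"]) (auto simp: finA finB dest: r_mem)
      have "?F \<subseteq> (\<lambda>(y1, y3, x3, y2). (x1, x2, x3, y1, y2, y3)) ` (common r x1 x2 \<times> ?S)"
        by (force simp: q all_thin_def hexagon_def common_def)
      then have "card ?F \<le> card (common r x1 x2 \<times> ?S)"
        by (rule surj_card_le[rotated]) (intro finite_cartesian_product finite_common finS)
      also have "\<dots> \<le> 3 * (9 + 6 * ?d x1 + 6 * ?d x2)"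
        unfolding card_cartesian_product
        using True card_thin_paths_le[of x1 x2] by (intro mult_mono card_common_le) auto
      finally show ?thesis by (simp add: q)
    next
      case False
      then have "?F = {}" by (auto simp: q all_thin_def hexagon_def)
      then show ?thesis by (simp only: card.empty)
    qed
  qed
  also have "\<dots> = (\<Sum>x\<in>A. \<Sum>x'\<in>A. 27 + 18 * ?d x + 18 * ?d x')"
    by (simp add: sum.cartesian_product case_prod_beta algebra_simps)
  also have "\<dots> = 27 * (card A)\<^sup>2 + 36 * card A * edges"
    by (simp add: edges_eq_sum(1) sum.distrib power2_eq_square algebra_simps
        flip: sum_distrib_left sum_distrib_right)
  also have "\<dots> \<le> 27 * N\<^sup>2 + 36 * N * edges"
    by (intro add_mono mult_mono power_mono) (auto simp: N_def)
  finally show ?thesis .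
qed

section \<open>Bounds in powers of the number of vertices\<close>

lemma real_edges_le: "real edges \<le> 5 * real N powr (3/2)"
proof (rule power2_le_imp_le)
  have "real (edges\<^sup>2) \<le> real (17 * N ^ 3)" using edges_square_le by (simp only: of_nat_le_iff)
  \<comment> \<open>17 is enlarged to a square so that the root has the integer factor 5.\<close>
  also have "\<dots> \<le> 25 * real N ^ 3" by simp
  also have "\<dots> = (5 * real N powr (3/2))\<^sup>2"
    by (cases "N = 0") (simp_all add: power_mult_distrib powr_power powr_numeral)
  finally show "(real edges)\<^sup>2 \<le> (5 * real N powr (3/2))\<^sup>2" by simp
qed simp

lemma N_edges_le: "real N * real edges \<le> 5 * real N powr (5/2)"
proof -
  have "real N * real edges \<le> real N * (5 * real N powr (3/2))"
    by (intro mult_left_mono real_edges_le) auto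
  also have "\<dots> = 5 * real N powr (5/2)"
    using powr_add[of "real N" 1 "3/2"] by (cases "N = 0") auto
  finally show ?thesis .
qed

lemma N_square_le: "(real N)\<^sup>2 \<le> real N powr (5/2)"
  using powr_mono[of 2 "5/2" "real N"] by (cases "N = 0") (auto simp: powr_numeral)

text \<open>The constants are \<open>2280 = 5 * (384 + 72)\<close> and
  \<open>207 = 27 + 5 * 36\<close>.\<close>

lemma real_card_thin_le: "real (card (one_thin r) + card (two_thin r)) \<le> 2280 * real N powr (5/2)"
    "real (card (all_thin r)) \<le> 207 * real N powr (5/2)"
proof -
  have "real (card (one_thin r) + card (two_thin r)) \<le> real (384 * N * edges + 72 * N * edges)"
    using card_one_thin_le card_two_thin_le by (simp only: of_nat_le_iff)
  also have "\<dots> = 456 * (real N * real edges)" by simp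
  finally show "real (card (one_thin r) + card (two_thin r)) \<le> 2280 * real N powr (5/2)" using N_edges_le by simp
  have "real (card (all_thin r)) \<le> real (27 * N\<^sup>2 + 36 * N * edges)"
    using card_all_thin_le by (simp only: of_nat_le_iff)
  also have "\<dots> = 27 * (real N)\<^sup>2 + 36 * (real N * real edges)" by simp
  finally show "real (card (all_thin r)) \<le> 207 * real N powr (5/2)" using N_edges_le N_square_le by simp
qed

end

section \<open>6-cycles with a fat triangle\<close>

text \<open>The map to \<open>(y1, y2, y3)\<close> is injective: \<open>fat_triangle_unique\<close>
  recovers the set of the other three vertices, and sortedness recovers their labels.\<close>

lemma card_fat_hexagons_le:
  fixes r :: "'a :: linorder \<Rightarrow> 'b \<Rightarrow> bool"
  assumes "c8_free A B r"
  shows "card (sorted_fat r) \<le> card B ^ 3" "finite (sorted_fat r)"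
proof -
  interpret c8_free A B r by (rule assms)
  have inj: "inj_on (\<lambda>(x1, x2, x3, y). y) (sorted_fat r)"
  proof (rule inj_onI)
    fix s t assume st: "s \<in> sorted_fat r" "t \<in> sorted_fat r"
      and eq: "(case s of (x1, x2, x3, y) \<Rightarrow> y) = (case t of (x1, x2, x3, y) \<Rightarrow> y)"
    obtain x1 x2 x3 y1 y2 y3 where s: "s = (x1, x2, x3, y1, y2, y3)" by (metis prod.exhaust)
    obtain x1' x2' x3' where t: "t = (x1', x2', x3', y1, y2, y3)"
      using eq s by (cases t) auto
    have sorted: "x1 < x2" "x2 < x3" "x1' < x2'" "x2' < x3'"
      using st s t by (auto simp: sorted_fat_def)
    have "{x1, x2, x3} = {x1', x2', x3'}"
      by (rule fat_triangle_unique[of _ _ _ y1 y2 y3]) (use st s t in \<open>auto simp: sorted_fat_def\<close>)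
    then have "set [x1, x2, x3] = set [x1', x2', x3']" by simp
    then have "[x1, x2, x3] = [x1', x2', x3']"
      using sorted by (intro sorted_distinct_set_unique) auto
    then show "s = t" using s t by simp
  qed
  have img: "(\<lambda>(x1, x2, x3, y). y) ` sorted_fat r \<subseteq> B \<times> B \<times> B"
    using hexagon_mem by (auto simp: sorted_fat_def)
  have "card (sorted_fat r) \<le> card (B \<times> B \<times> B)"
    by (rule card_inj_on_le[OF inj img]) (simp add: finB)
  then show "card (sorted_fat r) \<le> card B ^ 3"
    by (simp add: card_cartesian_product power3_eq_cube)
  show "finite (sorted_fat r)"
    by (rule inj_on_finite[OF inj img]) (simp add: finB)
qed

section \<open>Relabelling 6-cycles\<close>

definition hex_edges :: "nat \<times> nat \<times> nat \<times> nat \<times> nat \<times> nat \<Rightarrow> nat set set" where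
  "hex_edges = (\<lambda>(x1, x2, x3, y1, y2, y3).
     {{x1, y1}, {x2, y1}, {x2, y2}, {x3, y2}, {x3, y3}, {x1, y3}})"

text \<open>These are the two rotations and three reflections that preserve the parts; each y-vertex
  moves along with the two x-vertices that it joins.\<close>

lemma hex_edges_perms:
  "hex_edges (x2, x3, x1, y2, y3, y1) = hex_edges (x1, x2, x3, y1, y2, y3)"
  "hex_edges (x3, x1, x2, y3, y1, y2) = hex_edges (x1, x2, x3, y1, y2, y3)"
  "hex_edges (x2, x1, x3, y1, y3, y2) = hex_edges (x1, x2, x3, y1, y2, y3)"
  "hex_edges (x1, x3, x2, y3, y2, y1) = hex_edges (x1, x2, x3, y1, y2, y3)"
  "hex_edges (x3, x2, x1, y2, y1, y3) = hex_edges (x1, x2, x3, y1, y2, y3)"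
  by (auto simp: hex_edges_def)

lemma hexagon_perms:
  assumes "hexagon r x1 x2 x3 y1 y2 y3"
  shows "hexagon r x2 x3 x1 y2 y3 y1" "hexagon r x3 x1 x2 y3 y1 y2" "hexagon r x2 x1 x3 y1 y3 y2"
    "hexagon r x1 x3 x2 y3 y2 y1" "hexagon r x3 x2 x1 y2 y1 y3"
  using assms by (auto simp: hexagon_def)

text \<open>One of the six relabellings sorts the x-vertices, and being pairwise fat does not depend
  on the labels.\<close>

lemma sorted_fat_cover:
  assumes h: "hexagon r x1 x2 x3 y1 y2 y3" and f: "fat_triangle r x1 x2 x3"
  shows "hex_edges (x1, x2, x3, y1, y2, y3) \<in> hex_edges ` sorted_fat r"
proof -
  note hs = h hexagon_perms[OF h]
  have fs: "fat_triangle r x2 x3 x1" "fat_triangle r x3 x1 x2" "fat_triangle r x2 x1 x3"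
    "fat_triangle r x1 x3 x2" "fat_triangle r x3 x2 x1"
    using f fat_sym[of r] by (auto simp: fat_triangle_def)
  have "x1 \<noteq> x2" "x1 \<noteq> x3" "x2 \<noteq> x3" using h by (auto simp: hexagon_def)
  then consider "x1 < x2" "x2 < x3" | "x1 < x3" "x3 < x2" | "x2 < x1" "x1 < x3" | "x2 < x3" "x3 < x1"
    | "x3 < x1" "x1 < x2" | "x3 < x2" "x2 < x1" by fastforce
  then show ?thesis
  proof cases
    case 1 then show ?thesis using hs f
      by (intro image_eqI[where f = hex_edges, OF refl]) (auto simp: sorted_fat_def)
  next
    case 2 then show ?thesis using hs fs
      by (intro image_eqI[where f = hex_edges, OF hex_edges_perms(4)[symmetric]]) (auto simp: sorted_fat_def)
  next
    case 3 then show ?thesis using hs fs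
      by (intro image_eqI[where f = hex_edges, OF hex_edges_perms(3)[symmetric]]) (auto simp: sorted_fat_def)
  next
    case 4 then show ?thesis using hs fs
      by (intro image_eqI[where f = hex_edges, OF hex_edges_perms(1)[symmetric]]) (auto simp: sorted_fat_def)
  next
    case 5 then show ?thesis using hs fs
      by (intro image_eqI[where f = hex_edges, OF hex_edges_perms(2)[symmetric]]) (auto simp: sorted_fat_def)
  next
    case 6 then show ?thesis using hs fs
      by (intro image_eqI[where f = hex_edges, OF hex_edges_perms(5)[symmetric]]) (auto simp: sorted_fat_def)
  qed
qed

text \<open>With one or two thin pairs, a rotation brings the exceptional pair to its prescribed
  position. The second alternative is left open so that the lemma can then be applied with the parts
  exchanged.\<close>

lemma hexagon_cases:
  assumes h: "hexagon r x1 x2 x3 y1 y2 y3"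
  obtains "hex_edges (x1, x2, x3, y1, y2, y3)
      \<in> hex_edges ` (sorted_fat r \<union> (one_thin r \<union> two_thin r))"
    | "\<not> fat r x1 x2" "\<not> fat r x1 x3" "\<not> fat r x2 x3"
proof -
  let ?t = "(x1, x2, x3, y1, y2, y3)"
  let ?U = "sorted_fat r \<union> (one_thin r \<union> two_thin r)"
  note hs = h hexagon_perms[OF h]
  have rot1: "hex_edges ?t \<in> hex_edges ` ?U" if "(x2, x3, x1, y2, y3, y1) \<in> ?U"
    by (rule image_eqI[where f = hex_edges, OF hex_edges_perms(1)[symmetric] that])
  have rot2: "hex_edges ?t \<in> hex_edges ` ?U" if "(x3, x1, x2, y3, y1, y2) \<in> ?U"
    by (rule image_eqI[where f = hex_edges, OF hex_edges_perms(2)[symmetric] that])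
  have fs: "fat r x2 x1 = fat r x1 x2" "fat r x3 x1 = fat r x1 x3" "fat r x3 x2 = fat r x2 x3"
    using fat_sym by metis+
  show ?thesis
  proof (cases "fat r x1 x2"; cases "fat r x1 x3"; cases "fat r x2 x3")
    assume "fat r x1 x2" "fat r x1 x3" "fat r x2 x3"
    then show ?thesis using that(1) sorted_fat_cover[OF h] by (auto simp: fat_triangle_def)
  next
    assume "fat r x1 x2" "fat r x1 x3" "\<not> fat r x2 x3"
    then show ?thesis using hs fs by (intro that(1) rot1) (auto simp: one_thin_def)
  next
    assume "fat r x1 x2" "\<not> fat r x1 x3" "fat r x2 x3"
    then show ?thesis using hs fs by (intro that(1) rot2) (auto simp: one_thin_def)
  next
    assume "\<not> fat r x1 x2" "fat r x1 x3" "fat r x2 x3"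
    then show ?thesis using hs by (intro that(1) imageI) (auto simp: one_thin_def)
  next
    assume "fat r x1 x2" "\<not> fat r x1 x3" "\<not> fat r x2 x3"
    then show ?thesis using hs fs by (intro that(1) rot2) (auto simp: two_thin_def)
  next
    assume "\<not> fat r x1 x2" "fat r x1 x3" "\<not> fat r x2 x3"
    then show ?thesis using hs fs by (intro that(1) rot1) (auto simp: two_thin_def)
  next
    assume "\<not> fat r x1 x2" "\<not> fat r x1 x3" "fat r x2 x3"
    then show ?thesis using hs by (intro that(1) imageI) (auto simp: two_thin_def)
  qed (rule that(2))
qed

section \<open>The upper bound for cycle subgraphs\<close>

lemma cycle_subgraphsI:
  assumes "distinct xs" "length xs = k" "\<And>i. i < k \<Longrightarrow> {xs ! i, xs ! ((i + 1) mod k)} \<in> E"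
  shows "{{xs ! i, xs ! ((i + 1) mod k)} | i. i < k} \<in> cycle_subgraphs k E"
  unfolding cycle_subgraphs_def using assms
  by (auto intro!: exI[of _ "(!) xs"] inj_on_nth)

lemma cycle6_edges:
  "{{f i, f ((i + 1) mod 6)} | i. i < (6::nat)} =
     {{f 0, f 1}, {f 1, f 2}, {f 2, f 3}, {f 3, f 4}, {f 4, f 5}, {f 5, f 0}}"
proof -
  have "{..<6::nat} = {0, 1, 2, 3, 4, 5}" by auto
  moreover have "{{f i, f ((i + 1) mod 6)} | i. i < (6::nat)} = (\<lambda>i. {f i, f ((i + 1) mod 6)}) ` {..<6}"
    by auto
  ultimately show ?thesis by (simp flip: numeral_2_eq_2)
qed

lemma less_8_cases: "i < (8::nat) \<longleftrightarrow> i \<in> {0, 1, 2, 3, 4, 5, 6, 7}"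
  by auto

text \<open>Each 6-cycle falls into a class of \<open>hexagon_cases\<close> for one of the two parts
  or is thin in both. The first kind of error is paid once per part:
  \<open>4767 = 2 * 2280 + 207\<close>.\<close>

lemma num_hexagons_le:
  assumes E: "simple_graph_on n E" "bipartite E" "cycle_subgraphs 8 E = {}"
  shows "real (num_cycles 6 E) \<le> real n ^ 3 + 4767 * real n powr (5/2)"
proof -
  obtain P where P: "{u, v} \<in> E \<Longrightarrow> u \<in> P \<longleftrightarrow> v \<notin> P" for u v
    using E(2) unfolding bipartite_def by blast
  have E_less: "u < n" "v < n" if "{u, v} \<in> E" for u v
    using E(1) that unfolding simple_graph_on_def by (auto simp: doubleton_eq_iff)
  define A where "A = {x. x < n \<and> x \<in> P}"
  define B where "B = {x. x < n \<and> x \<notin> P}"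
  \<comment> \<open>The conjunct \<open>x \<in> P\<close> directs every edge from \<open>A\<close>
    to \<open>B\<close>, since both parts consist of natural numbers here.\<close>
  define r where "r x y \<longleftrightarrow> x \<in> P \<and> {x, y} \<in> E" for x y
  let ?r' = "\<lambda>y x. r x y"
  have free: "c8_free A B r"
  proof
    show "finite A" "finite B" by (auto simp: A_def B_def)
    show "x \<in> A" "y \<in> B" if "r x y" for x y
      using that P[of x y] E_less[of x y] by (auto simp: A_def B_def r_def)
    fix x1 x2 x3 x4 y1 y2 y3 y4
    assume d: "distinct [x1, x2, x3, x4]" "distinct [y1, y2, y3, y4]"
      and rr: "r x1 y1" "r x2 y1" "r x2 y2" "r x3 y2" "r x3 y3" "r x4 y3" "r x4 y4" "r x1 y4"
    let ?xs = "[x1, y1, x2, y2, x3, y3, x4, y4]"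
    have P': "x1 \<in> P" "x2 \<in> P" "x3 \<in> P" "x4 \<in> P" "y1 \<notin> P" "y2 \<notin> P" "y3 \<notin> P" "y4 \<notin> P"
      using rr P by (auto simp: r_def)
    then have "distinct ?xs" using d by auto
    moreover have "{?xs ! i, ?xs ! ((i + 1) mod 8)} \<in> E" if "i < 8" for i
      using that rr unfolding less_8_cases by (auto simp: r_def insert_commute)
    ultimately have "{{?xs ! i, ?xs ! ((i + 1) mod 8)} | i. i < 8} \<in> cycle_subgraphs 8 E"
      by (intro cycle_subgraphsI) simp_all
    then show False using E(3) by simp
  qed
  interpret c8_free A B r by (rule free)
  interpret d: c8_free B A ?r' by (rule dual)
  have AB: "card A + card B = n"
  proof -
    have "A \<union> B = {..<n}" "A \<inter> B = {}" by (auto simp: A_def B_def)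
    then show ?thesis using card_Un_disjoint[OF finA finB] by simp
  qed
  then have N: "N = n" "d.N = n" by (simp_all add: N_def d.N_def)
  let ?U = "sorted_fat r \<union> (one_thin r \<union> two_thin r)"
  let ?U' = "sorted_fat ?r' \<union> (one_thin ?r' \<union> two_thin ?r')"
  have cover: "cycle_subgraphs 6 E \<subseteq> hex_edges ` ?U \<union> (hex_edges ` ?U' \<union> hex_edges ` all_thin r)"
  proof
    fix F assume "F \<in> cycle_subgraphs 6 E"
    then obtain f where inj: "inj_on f {..<6::nat}" and FE: "F \<subseteq> E"
      and F: "F = {{f 0, f 1}, {f 1, f 2}, {f 2, f 3}, {f 3, f 4}, {f 4, f 5}, {f 5, f 0}}"
      unfolding cycle_subgraphs_def cycle6_edges by blast
    have ne: "f i \<noteq> f j" if "i < 6" "j < 6" "i \<noteq> j" for i j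
      using inj that by (auto dest: inj_onD)
    have alt: "f 0 \<in> P \<longleftrightarrow> f 1 \<notin> P" "f 1 \<in> P \<longleftrightarrow> f 2 \<notin> P" "f 2 \<in> P \<longleftrightarrow> f 3 \<notin> P"
      "f 3 \<in> P \<longleftrightarrow> f 4 \<notin> P" "f 4 \<in> P \<longleftrightarrow> f 5 \<notin> P"
      using P FE F by auto
    have "\<exists>x1 x2 x3 y1 y2 y3. hexagon r x1 x2 x3 y1 y2 y3 \<and> F = hex_edges (x1, x2, x3, y1, y2, y3)"
    \<comment> \<open>A cycle starting in \<open>B\<close> is read from its second vertex on, so
      that its x-vertices lie in \<open>A\<close>.\<close>
    proof (cases "f 0 \<in> P")
      case True
      have "hexagon r (f 0) (f 2) (f 4) (f 1) (f 3) (f 5)"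
        unfolding hexagon_def r_def using ne alt True FE F by (simp add: insert_commute)
      moreover have "F = hex_edges (f 0, f 2, f 4, f 1, f 3, f 5)"
        by (auto simp: F hex_edges_def insert_commute)
      ultimately show ?thesis by blast
    next
      case False
      have "hexagon r (f 1) (f 3) (f 5) (f 2) (f 4) (f 0)"
        unfolding hexagon_def r_def using ne alt False FE F by (simp add: insert_commute)
      moreover have "F = hex_edges (f 1, f 3, f 5, f 2, f 4, f 0)"
        by (auto simp: F hex_edges_def insert_commute)
      ultimately show ?thesis by blast
    qed
    then obtain x1 x2 x3 y1 y2 y3 where h: "hexagon r x1 x2 x3 y1 y2 y3"
      and Fh: "F = hex_edges (x1, x2, x3, y1, y2, y3)" by blast
    \<comment> \<open>With the parts exchanged, \<open>x2\<close> joins \<open>y1\<close> and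
      \<open>y2\<close>, \<open>x3\<close> joins \<open>y2\<close> and \<open>y3\<close>, and
      \<open>x1\<close> closes the cycle.\<close>
    have h': "hexagon ?r' y1 y2 y3 x2 x3 x1" using h by (auto simp: hexagon_def)
    have Fh': "F = hex_edges (y1, y2, y3, x2, x3, x1)"
      unfolding Fh by (auto simp: hex_edges_def insert_commute)
    show "F \<in> hex_edges ` ?U \<union> (hex_edges ` ?U' \<union> hex_edges ` all_thin r)"
    proof (rule hexagon_cases[OF h])
      assume thin: "\<not> fat r x1 x2" "\<not> fat r x1 x3" "\<not> fat r x2 x3"
      show ?thesis
      proof (rule hexagon_cases[OF h'])
        assume "\<not> fat ?r' y2 y3"
        with thin h show ?thesis by (auto simp: all_thin_def Fh)
      qed (auto simp: Fh')
    qed (auto simp: Fh)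
  qed
  have fin: "finite ?U" "finite ?U'"
    using card_fat_hexagons_le(2)[OF free] card_fat_hexagons_le(2)[OF dual]
    by (simp_all add: finite_thin d.finite_thin)
  have "card (cycle_subgraphs 6 E)
      \<le> card (hex_edges ` ?U \<union> (hex_edges ` ?U' \<union> hex_edges ` all_thin r))"
    by (rule card_mono[OF _ cover]) (intro finite_UnI finite_imageI fin finite_thin)
  also have "\<dots> \<le> card ?U + (card ?U' + card (all_thin r))"
    by (intro order_trans[OF card_Un_le] add_mono card_image_le fin finite_thin)
  also have "\<dots> \<le> (card (sorted_fat r) + (card (one_thin r) + card (two_thin r)))
      + ((card (sorted_fat ?r') + (card (one_thin ?r') + card (two_thin ?r'))) + card (all_thin r))"
    by (intro order_trans[OF card_Un_le] add_mono order_refl)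
  also have "\<dots> \<le> (card B ^ 3 + (card (one_thin r) + card (two_thin r)))
      + ((card A ^ 3 + (card (one_thin ?r') + card (two_thin ?r'))) + card (all_thin r))"
    by (intro add_mono order_refl card_fat_hexagons_le(1)[OF free] card_fat_hexagons_le(1)[OF dual])
  also have "\<dots> \<le> n ^ 3 + ((card (one_thin r) + card (two_thin r))
      + (card (one_thin ?r') + card (two_thin ?r')) + card (all_thin r))"
    unfolding AB[symmetric] by (simp add: power3_eq_cube algebra_simps)
  finally have "real (num_cycles 6 E) \<le> real (n ^ 3 + ((card (one_thin r) + card (two_thin r))
      + (card (one_thin ?r') + card (two_thin ?r')) + card (all_thin r)))"
    unfolding num_cycles_def by (simp only: of_nat_le_iff)
  also have "\<dots> = real n ^ 3 + (real (card (one_thin r) + card (two_thin r))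
      + real (card (one_thin ?r') + card (two_thin ?r')) + real (card (all_thin r)))"
    by simp
  also have "\<dots> \<le> real n ^ 3 + (2280 * real n powr (5/2) + 2280 * real n powr (5/2)
      + 207 * real n powr (5/2))"
    using real_card_thin_le d.real_card_thin_le unfolding N by (intro add_mono) auto
  finally show ?thesis by simp
qed

section \<open>The lower bound\<close>

text \<open>Not the triangle, but the complete bipartite graph with parts \<open>{0, 1, 2}\<close>
  and \<open>{3..<n}\<close>.\<close>

definition K3 :: "nat \<Rightarrow> nat set set" where
  "K3 n = {{x, y} | x y. x < 3 \<and> 3 \<le> y \<and> y < n}"

lemma K3_iff: "{u, v} \<in> K3 n \<longleftrightarrow> (u < 3 \<and> 3 \<le> v \<and> v < n) \<or> (v < 3 \<and> 3 \<le> u \<and> u < n)"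
  by (auto simp: K3_def doubleton_eq_iff)

lemma K3_admissible: "simple_graph_on n (K3 n)" "bipartite (K3 n)" "cycle_subgraphs 8 (K3 n) = {}"
proof -
  show "simple_graph_on n (K3 n)" unfolding simple_graph_on_def K3_def by fastforce
  show "bipartite (K3 n)" unfolding bipartite_def by (intro exI[of _ "{..<3}"]) (auto simp: K3_iff)
  have four: False if "inj_on f {..<8::nat}" "a < 8" "b < 8" "c < 8" "d < 8" "distinct [a, b, c, d]"
    "f a < 3" "f b < 3" "f c < 3" "f d < 3" for f :: "nat \<Rightarrow> nat" and a b c d
  proof -
    have "inj_on f {a, b, c, d}" by (rule inj_on_subset[OF that(1)]) (use that in auto)
    then have "card (f ` {a, b, c, d}) = 4" using that by (simp add: card_image)
    moreover have "card (f ` {a, b, c, d}) \<le> card {..<3::nat}"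
      by (rule card_mono) (use that in auto)
    ultimately show False by simp
  qed
  show "cycle_subgraphs 8 (K3 n) = {}"
  proof (rule ccontr)
    assume "cycle_subgraphs 8 (K3 n) \<noteq> {}"
    then obtain f where inj: "inj_on f {..<8::nat}"
      and sub: "{{f i, f ((i + 1) mod 8)} | i. i < 8} \<subseteq> K3 n"
      unfolding cycle_subgraphs_def by blast
    have e: "{f i, f ((i + 1) mod 8)} \<in> K3 n" if "i < 8" for i using sub that by blast
    have alt: "f i < 3 \<longleftrightarrow> \<not> f ((i + 1) mod 8) < 3" if "i < 8" for i
      using e[OF that] by (auto simp: K3_iff)
    \<comment> \<open>Either all even or all odd positions of the 8-cycle are mapped into
      \<open>{0, 1, 2}\<close>.\<close>
    show False
      using alt[of 0] alt[of 1] alt[of 2] alt[of 3] alt[of 4] alt[of 5] alt[of 6]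
        four[OF inj, of 0 2 4 6] four[OF inj, of 1 3 5 7]
      by (cases "f 0 < 3") (simp_all flip: numeral_2_eq_2)
  qed
qed

lemma finite_cycle_subgraphs: "finite E \<Longrightarrow> finite (cycle_subgraphs k E)"
  by (rule finite_subset[of _ "Pow E"]) (auto simp: cycle_subgraphs_def)

text \<open>With 0, 1, 2 as fixed x-labels, distinct ordered triples of other vertices give distinct
  6-cycles, as each y-vertex is recovered as the one joining its two x-vertices. The error term
  covers triples with a repetition.\<close>

lemma num_hexagons_K3_ge: "(n - 3) ^ 3 \<le> num_cycles 6 (K3 n) + 3 * (n - 3)\<^sup>2"
proof -
  let ?B = "{3..<n}"
  let ?T = "{(y1, y2, y3). y1 \<in> ?B \<and> y2 \<in> ?B \<and> y3 \<in> ?B \<and> distinct [y1, y2, y3]}"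
  let ?h = "\<lambda>(y1, y2, y3). hex_edges (0, 1, 2, y1, y2, y3)"
  let ?f1 = "\<lambda>(y, z). (y, y, z)" and ?f2 = "\<lambda>(y, z). (y, z, y)" and ?f3 = "\<lambda>(y, z). (z, y, y)"
  have finT: "finite ?T" by (rule finite_subset[of _ "?B \<times> ?B \<times> ?B"]) auto
  have "finite (K3 n)"
    by (rule finite_subset[of _ "Pow {..<n}"]) (auto simp: K3_def)
  have "card ?T \<le> num_cycles 6 (K3 n)"
    unfolding num_cycles_def
  proof (rule card_inj_on_le)
    show "inj_on ?h ?T"
    proof (rule inj_onI)
      fix s t assume "s \<in> ?T" "t \<in> ?T" and eq: "?h s = ?h t"
      moreover obtain y1 y2 y3 where s: "s = (y1, y2, y3)" by (metis prod.exhaust)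
      moreover obtain z1 z2 z3 where t: "t = (z1, z2, z3)" by (metis prod.exhaust)
      ultimately have m: "3 \<le> y1" "3 \<le> y2" "3 \<le> y3" "3 \<le> z1" "3 \<le> z2" "3 \<le> z3"
        "distinct [y1, y2, y3]" "distinct [z1, z2, z3]" by auto
      have iff: "{x, v} \<in> ?h s \<longleftrightarrow> {x, v} \<in> ?h t" for x v using eq by simp
      show "s = t"
        using iff[of 0 y1] iff[of 1 y1] iff[of 1 y2] iff[of 2 y2] iff[of 2 y3] iff[of 0 y3] m
        by (auto simp: s t hex_edges_def doubleton_eq_iff)
    qed
    show "?h ` ?T \<subseteq> cycle_subgraphs 6 (K3 n)"
    proof
      fix F assume "F \<in> ?h ` ?T"
      then obtain y1 y2 y3 where F: "F = hex_edges (0, 1, 2, y1, y2, y3)"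
        and y: "y1 \<in> ?B" "y2 \<in> ?B" "y3 \<in> ?B" "distinct [y1, y2, y3]" by auto
      let ?xs = "[0, y1, 1, y2, 2, y3]"
      have "distinct ?xs" using y by auto
      moreover have "{?xs ! i, ?xs ! ((i + 1) mod 6)} \<in> K3 n" if "i < 6" for i
      proof -
        have "i \<in> {0, 1, 2, 3, 4, 5}" using that by auto
        then show ?thesis using y by (auto simp: K3_iff)
      qed
      ultimately have "{{?xs ! i, ?xs ! ((i + 1) mod 6)} | i. i < 6} \<in> cycle_subgraphs 6 (K3 n)"
        by (intro cycle_subgraphsI) simp_all
      also have "{{?xs ! i, ?xs ! ((i + 1) mod 6)} | i. i < 6} = F"
        unfolding cycle6_edges F by (auto simp: hex_edges_def insert_commute)
      finally show "F \<in> cycle_subgraphs 6 (K3 n)" .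
    qed
    show "finite (cycle_subgraphs 6 (K3 n))" by (rule finite_cycle_subgraphs) fact
  qed
  \<comment> \<open>A triple with a repetition has one of three shapes, each parametrised by
    \<open>?B \<times> ?B\<close>.\<close>
  have "card (?B \<times> ?B \<times> ?B)
      \<le> card (?T \<union> (?f1 ` (?B \<times> ?B) \<union> (?f2 ` (?B \<times> ?B) \<union> ?f3 ` (?B \<times> ?B))))"
    by (rule card_mono) (use finT in \<open>auto simp: image_iff\<close>)
  also have "\<dots> \<le> card ?T + (card (?B \<times> ?B) + (card (?B \<times> ?B) + card (?B \<times> ?B)))"
    by (intro order_trans[OF card_Un_le] add_mono card_image_le) auto
  also have "\<dots> \<le> num_cycles 6 (K3 n) + 3 * (n - 3)\<^sup>2"
    using \<open>card ?T \<le> _\<close> by (simp add: card_cartesian_product power2_eq_square)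
  finally show ?thesis by (simp add: card_cartesian_product power3_eq_cube)
qed

theorem theorem10:
  shows "(\<lambda>n. real (ex_bip_C6_C8 n) - real n ^ 3) \<in> O(\<lambda>n. real n powr (5/2))"
\<comment> \<open>The constant is that of \<open>num_hexagons_le\<close>; from 3 on, the truncated
  difference \<open>n - 3\<close> agrees with the real one.\<close>
proof (rule bigoI[where c = 4767], rule eventually_sequentiallyI[of 3])
  fix n :: nat assume n: "3 \<le> n"
  let ?S = "{num_cycles 6 E | E. simple_graph_on n E \<and> bipartite E \<and> cycle_subgraphs 8 E = {}}"
  have "?S \<subseteq> num_cycles 6 ` Pow (Pow {..<n})"
    by (force simp: simple_graph_on_def)
  then have fin: "finite ?S" by (rule finite_subset) simp
  have K3: "num_cycles 6 (K3 n) \<in> ?S" using K3_admissible by blast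
  then have "Max ?S \<in> ?S" using fin by (intro Max_in) auto
  then have up: "real (ex_bip_C6_C8 n) \<le> real n ^ 3 + 4767 * real n powr (5/2)"
    unfolding ex_bip_C6_C8_def using num_hexagons_le by auto
  have "num_cycles 6 (K3 n) \<le> ex_bip_C6_C8 n"
    unfolding ex_bip_C6_C8_def using fin K3 by (rule Max_ge)
  then have "(n - 3) ^ 3 \<le> ex_bip_C6_C8 n + 3 * (n - 3)\<^sup>2"
    using num_hexagons_K3_ge[of n] by simp
  then have "real ((n - 3) ^ 3) \<le> real (ex_bip_C6_C8 n + 3 * (n - 3)\<^sup>2)"
    by (simp only: of_nat_le_iff)
  then have "(real n - 3) ^ 3 \<le> real (ex_bip_C6_C8 n) + 3 * (real n - 3)\<^sup>2"
    using n by (simp add: of_nat_diff)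
  \<comment> \<open>The term dropped after expanding is \<open>45 * n - 54\<close>, which is
    positive for \<open>n \<ge> 3\<close>.\<close>
  then have "real n ^ 3 - 12 * (real n)\<^sup>2 \<le> real (ex_bip_C6_C8 n)"
    using n by (simp add: power2_eq_square power3_eq_cube algebra_simps)
  moreover have "(real n)\<^sup>2 \<le> real n powr (5/2)"
    using powr_mono[of 2 "5/2" "real n"] n by (simp add: powr_numeral)
  ultimately show "norm (real (ex_bip_C6_C8 n) - real n ^ 3) \<le> 4767 * norm (real n powr (5/2))"
    using up by (simp add: abs_le_iff)
qed

end
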